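(* Let $h:(S,R)\to(T,M)$ be a morphism of the category $\mathcal{E}$. Then the map $$Q(h):Q(S,R)\to Q(T,M),\qquad r+\psi_{(S,R)}(N(S))\mapsto h(r)+\psi_{(T,M)}(N(T))$$ is well defined and is a homomorphism of unitary rings.
   Context: "Ring" means commutative ring, not necessarily with identity. Prime ideals are proper by definition. $N(S)$ denotes the nilradical of a ring $S$, i.e. the intersection of all prime ideals of $S$ (equal to $S$ if there are none). An i-extension of $S$ is a ring $R$ containing $S$ as an ideal. For an i-extension $R$ of $S$ and an ideal $I$ of $S$, put $\psi_{(S,R)}(I)=\{x\in R: xS\subseteq I\}$, which is an ideal of $R$. $\mathcal{E}$ is the category whose objects are the pairs $(S,R)$ with $R$ a unitary ring that is an i-extension of the ring $S$, and whose morphisms $(S_1,R_1)\to(S_2,R_2)$ are the homomorphisms of unitary rings (preserving the identity) $h:R_1\to R_2$ such that $h(S_1)=S_2$. For an object $(S,R)$ of $\mathcal{E}$, $Q(S,R)=R/\psi_{(S,R)}(N(S))$. *)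

theory Defs
  imports "HOL-Algebra.QuotRing"
begin

text \<open>
  Commutative rings not necessarily with identity are represented by the ring records of
  HOL-Algebra; the \<open>one\<close> field of such a record is left unconstrained and is never used.
  Commutative rings with identity are the locale \<^locale>\<open>cring\<close>, which admits the zero ring.
\<close>

locale comm_rng = abelian_group R for R (structure) +
  assumes m_closed: "\<lbrakk>x \<in> carrier R; y \<in> carrier R\<rbrakk> \<Longrightarrow> x \<otimes> y \<in> carrier R"
    and m_assoc: "\<lbrakk>x \<in> carrier R; y \<in> carrier R; z \<in> carrier R\<rbrakk>
      \<Longrightarrow> (x \<otimes> y) \<otimes> z = x \<otimes> (y \<otimes> z)"
    and m_comm: "\<lbrakk>x \<in> carrier R; y \<in> carrier R\<rbrakk> \<Longrightarrow> x \<otimes> y = y \<otimes> x"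
    and l_distr: "\<lbrakk>x \<in> carrier R; y \<in> carrier R; z \<in> carrier R\<rbrakk>
      \<Longrightarrow> (x \<oplus> y) \<otimes> z = x \<otimes> z \<oplus> y \<otimes> z"

text \<open>The library's \<^locale>\<open>ideal\<close> and \<^locale>\<open>primeideal\<close> presuppose an identity.\<close>

locale rng_ideal = additive_subgroup I R + comm_rng R for I and R (structure) +
  assumes ideal_closed: "\<lbrakk>a \<in> I; x \<in> carrier R\<rbrakk> \<Longrightarrow> x \<otimes> a \<in> I"

locale rng_primeideal = rng_ideal +
  assumes I_notcarr: "carrier R \<noteq> I"
    and I_prime: "\<lbrakk>a \<in> carrier R; b \<in> carrier R; a \<otimes> b \<in> I\<rbrakk> \<Longrightarrow> a \<in> I \<or> b \<in> I"

definition nilradical :: "('a, 'm) ring_scheme \<Rightarrow> 'a set" where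
  "nilradical S = {x \<in> carrier S. \<forall>P. rng_primeideal P S \<longrightarrow> x \<in> P}"

text \<open>
  \<open>S\<close> is a ring in its own right whose operations are those of \<open>R\<close>; agreement of the zeros
  follows from agreement of the additions.
\<close>

definition i_extension :: "('a, 'm) ring_scheme \<Rightarrow> ('a, 'n) ring_scheme \<Rightarrow> bool" where
  "i_extension S R \<longleftrightarrow> comm_rng S \<and> comm_rng R \<and> rng_ideal (carrier S) R \<and>
     (\<forall>x\<in>carrier S. \<forall>y\<in>carrier S.
        x \<oplus>\<^bsub>S\<^esub> y = x \<oplus>\<^bsub>R\<^esub> y \<and> x \<otimes>\<^bsub>S\<^esub> y = x \<otimes>\<^bsub>R\<^esub> y)"

definition psi :: "('a, 'm) ring_scheme \<Rightarrow> ('a, 'n) ring_scheme \<Rightarrow> 'a set \<Rightarrow> 'a set" where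
  "psi S R I = {x \<in> carrier R. \<forall>s\<in>carrier S. x \<otimes>\<^bsub>R\<^esub> s \<in> I}"

definition E_object :: "('a, 'm) ring_scheme \<Rightarrow> ('a, 'n) ring_scheme \<Rightarrow> bool" where
  "E_object S R \<longleftrightarrow> cring R \<and> i_extension S R"

definition E_morphism ::
  "('a \<Rightarrow> 'b) \<Rightarrow> ('a, 'm) ring_scheme \<Rightarrow> ('a, 'n) ring_scheme \<Rightarrow>
   ('b, 'p) ring_scheme \<Rightarrow> ('b, 'q) ring_scheme \<Rightarrow> bool" where
  "E_morphism h S R T M \<longleftrightarrow> E_object S R \<and> E_object T M \<and>
     h \<in> ring_hom R M \<and> h ` carrier S = carrier T"

definition Q_obj :: "('a, 'm) ring_scheme \<Rightarrow> ('a, 'n) ring_scheme \<Rightarrow> 'a set ring" where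
  "Q_obj S R = R Quot (psi S R (nilradical S))"

text \<open>
  The coset \<open>X\<close> is sent to the common value of \<open>h r + \<psi>\<close> over all representatives \<open>r \<in> X\<close>;
  this is meaningful only if that value does not depend on the representative.
\<close>

definition Q_map ::
  "('a \<Rightarrow> 'b) \<Rightarrow> ('b, 'p) ring_scheme \<Rightarrow> ('b, 'q) ring_scheme \<Rightarrow> 'a set \<Rightarrow> 'b set" where
  "Q_map h T M X = the_elem ((\<lambda>r. psi T M (nilradical T) +>\<^bsub>M\<^esub> h r) ` X)"

text \<open>In the presence of an identity the notions above agree with those of the library.\<close>

lemma (in cring) comm_rng: "comm_rng R"
  by unfold_locales (simp_all add: m_assoc l_distr, rule m_comm)

lemma (in cring) rng_ideal_iff_ideal: "rng_ideal I R \<longleftrightarrow> ideal I R"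
proof
  assume "rng_ideal I R"
  then interpret I: rng_ideal I R .
  show "ideal I R"
    using I.ideal_closed I.a_Hcarr m_comm
    by unfold_locales metis+
next
  assume "ideal I R"
  then interpret I: ideal I R .
  show "rng_ideal I R"
    by (intro rng_ideal.intro rng_ideal_axioms.intro comm_rng I.is_additive_subgroup I.I_l_closed)
qed

lemma (in cring) rng_primeideal_iff_primeideal: "rng_primeideal P R \<longleftrightarrow> primeideal P R"
  using rng_ideal_iff_ideal is_cring
  by (auto simp: rng_primeideal_def rng_primeideal_axioms_def primeideal_def primeideal_axioms_def)

end

theory Submission
  imports Defs
begin

text \<open>
  Since \<open>h\<close> maps \<open>S\<close> onto \<open>T\<close>, the preimage in \<open>S\<close> of a prime ideal of \<open>T\<close> is again proper,
  hence prime, and so \<open>h\<close> carries the nilradical of \<open>S\<close> into that of \<open>T\<close>. If \<open>x S\<close> lies in the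
  nilradical of \<open>S\<close>, then \<open>h x T = h (x S)\<close> lies in that of \<open>T\<close>; thus \<open>h\<close> respects the ideals
  that are factored out.
\<close>

text \<open>The map is not assumed to be in \<open>ring_hom\<close>, which would also relate the
  unconstrained \<open>one\<close> fields of \<open>S\<close> and \<open>T\<close>; additivity and
  multiplicativity are therefore stated separately.\<close>

lemma rng_primeideal_vimage:
  assumes S: "comm_rng S" and P: "rng_primeideal P T"
    and add: "h \<in> hom (add_monoid S) (add_monoid T)"
    and mult: "\<And>x y. \<lbrakk>x \<in> carrier S; y \<in> carrier S\<rbrakk> \<Longrightarrow> h (x \<otimes>\<^bsub>S\<^esub> y) = h x \<otimes>\<^bsub>T\<^esub> h y"
    and surj: "h ` carrier S = carrier T"
  shows "rng_primeideal {x \<in> carrier S. h x \<in> P} S"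
proof -
  interpret S: comm_rng S by (fact S)
  interpret P: rng_primeideal P T by (fact P)
  interpret h: abelian_group_hom S T h
    by (intro abelian_group_homI group_hom.intro group_hom_axioms.intro add
        S.abelian_group_axioms P.abelian_group_axioms S.a_group P.a_group)
  have sub: "subgroup {x \<in> carrier S. h x \<in> P} (add_monoid S)"
  proof (rule S.add.subgroupI)
    have "\<zero>\<^bsub>S\<^esub> \<in> {x \<in> carrier S. h x \<in> P}" by simp
    then show "{x \<in> carrier S. h x \<in> P} \<noteq> {}" by blast
  qed (auto intro: P.a_inv_closed)
  show ?thesis
  proof (intro rng_primeideal.intro rng_ideal.intro rng_ideal_axioms.intro
      rng_primeideal_axioms.intro additive_subgroup.intro S sub)
    show "carrier S \<noteq> {x \<in> carrier S. h x \<in> P}"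
    proof
      assume "carrier S = {x \<in> carrier S. h x \<in> P}"
      \<comment> \<open>Surjectivity enters here: a preimage equal to all of \<open>S\<close> would
        force \<open>P\<close> to be all of \<open>T\<close>.\<close>
      then have "h ` carrier S \<subseteq> P" by auto
      then show False using P.I_notcarr P.a_subset by (simp add: surj)
    qed
    show "x \<otimes>\<^bsub>S\<^esub> a \<in> {x \<in> carrier S. h x \<in> P}"
      if "a \<in> {x \<in> carrier S. h x \<in> P}" "x \<in> carrier S" for a x
      using that by (simp add: mult S.m_closed P.ideal_closed)
    show "a \<in> {x \<in> carrier S. h x \<in> P} \<or> b \<in> {x \<in> carrier S. h x \<in> P}"
      if "a \<in> carrier S" "b \<in> carrier S" "a \<otimes>\<^bsub>S\<^esub> b \<in> {x \<in> carrier S. h x \<in> P}" for a b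
      using that P.I_prime[of "h a" "h b"] by (simp add: mult)
  qed
qed

lemma nilradical_image:
  assumes "comm_rng S"
    and "h \<in> hom (add_monoid S) (add_monoid T)"
    and "\<And>x y. \<lbrakk>x \<in> carrier S; y \<in> carrier S\<rbrakk> \<Longrightarrow> h (x \<otimes>\<^bsub>S\<^esub> y) = h x \<otimes>\<^bsub>T\<^esub> h y"
    and "h ` carrier S = carrier T"
    and "x \<in> nilradical S"
  shows "h x \<in> nilradical T"
proof -
  have "h x \<in> P" if "rng_primeideal P T" for P
    using rng_primeideal_vimage[OF assms(1) that assms(2-4)] assms(5)
    by (auto simp: nilradical_def)
  \<comment> \<open>Membership in \<open>carrier T\<close> remains to be checked; it is the whole
    condition when \<open>T\<close> has no prime ideals.\<close>
  then show ?thesis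
    using assms(4,5) by (auto simp: nilradical_def)
qed

text \<open>Prime ideals are additive subgroups, and intersections inherit this. Together with
  \<open>nilradical_add\<close> this serves to show that \<open>psi\<close> of the nilradical is an
  ideal.\<close>

lemma (in comm_rng) nilradical_zero: "\<zero> \<in> nilradical R"
  by (auto simp: nilradical_def rng_primeideal_def rng_ideal_def dest: additive_subgroup.zero_closed)

lemma (in comm_rng) nilradical_add:
  "\<lbrakk>x \<in> nilradical R; y \<in> nilradical R\<rbrakk> \<Longrightarrow> x \<oplus> y \<in> nilradical R"
  by (auto simp: nilradical_def rng_primeideal_def rng_ideal_def dest: additive_subgroup.a_closed)

text \<open>The additions agree on \<open>S\<close>, so the zero z of \<open>S\<close> satisfies z +
  z = z in the additive group of \<open>R\<close>, and cancellation there gives z = 0.\<close>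

lemma i_extension_zero:
  assumes "i_extension S R"
  shows "\<zero>\<^bsub>S\<^esub> = \<zero>\<^bsub>R\<^esub>"
proof -
  interpret S: comm_rng S using assms by (simp add: i_extension_def)
  interpret I: rng_ideal "carrier S" R using assms by (simp add: i_extension_def)
  have "\<zero>\<^bsub>S\<^esub> \<oplus>\<^bsub>R\<^esub> \<zero>\<^bsub>S\<^esub> = \<zero>\<^bsub>S\<^esub>"
    using assms S.l_zero[OF S.zero_closed] by (simp add: i_extension_def)
  then show ?thesis
    using I.a_Hcarr[OF S.zero_closed] by (metis I.add.l_cancel_one)
qed

text \<open>Sums are inherited from the nilradical, absorption comes from \<open>S\<close> being an
  ideal of \<open>R\<close>, and negatives come from absorption.\<close>

lemma psi_nilradical_ideal:
  assumes "E_object S R"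
  shows "ideal (psi S R (nilradical S)) R"
proof -
  let ?N = "nilradical S"
  have ext: "i_extension S R" using assms by (simp add: E_object_def)
  interpret R: cring R using assms by (simp add: E_object_def)
  interpret S: comm_rng S using ext by (simp add: i_extension_def)
  interpret I: rng_ideal "carrier S" R using ext by (simp add: i_extension_def)
  have S_carr: "s \<in> carrier R" if "s \<in> carrier S" for s
    using that by (rule I.a_Hcarr)
  have NS: "x \<in> carrier S" if "x \<in> ?N" for x
    using that by (simp add: nilradical_def)
  have N_add: "x \<oplus>\<^bsub>R\<^esub> y \<in> ?N" if "x \<in> ?N" "y \<in> ?N" for x y
    using S.nilradical_add[OF that] NS[OF that(1)] NS[OF that(2)] ext
    by (simp add: i_extension_def)
  have l_closed: "r \<otimes>\<^bsub>R\<^esub> x \<in> psi S R ?N"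
    if x: "x \<in> psi S R ?N" and r: "r \<in> carrier R" for x r
  proof -
    have "(r \<otimes>\<^bsub>R\<^esub> x) \<otimes>\<^bsub>R\<^esub> s \<in> ?N" if s: "s \<in> carrier S" for s
    proof -
      \<comment> \<open>The factor \<open>r\<close> is moved onto \<open>s\<close>: the product of
        \<open>r\<close> and \<open>s\<close> is again in \<open>S\<close>, so the condition on
        \<open>x\<close> applies to it.\<close>
      have "(r \<otimes>\<^bsub>R\<^esub> x) \<otimes>\<^bsub>R\<^esub> s = x \<otimes>\<^bsub>R\<^esub> (r \<otimes>\<^bsub>R\<^esub> s)"
        using x r S_carr[OF s] by (simp add: psi_def R.m_ac)
      then show ?thesis
        using x I.ideal_closed[OF s r] by (simp add: psi_def)
    qed
    then show ?thesis using x r by (simp add: psi_def)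
  qed
  show ?thesis
  proof (rule idealI)
    show "subgroup (psi S R ?N) (add_monoid R)"
    proof (rule R.add.subgroupI)
      have "\<zero>\<^bsub>R\<^esub> \<in> psi S R ?N"
        using S.nilradical_zero i_extension_zero[OF ext] S_carr by (simp add: psi_def)
      then show "psi S R ?N \<noteq> {}" by blast
      show "\<ominus>\<^bsub>R\<^esub> x \<in> psi S R ?N" if "x \<in> psi S R ?N" for x
      proof -
        \<comment> \<open>The identity of \<open>R\<close> turns negation into multiplication by -1,
          which \<open>l_closed\<close> covers.\<close>
        have "\<ominus>\<^bsub>R\<^esub> x = (\<ominus>\<^bsub>R\<^esub> \<one>\<^bsub>R\<^esub>) \<otimes>\<^bsub>R\<^esub> x"
          using that by (simp add: psi_def R.l_minus)
        then show ?thesis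
          using l_closed[OF that, of "\<ominus>\<^bsub>R\<^esub> \<one>\<^bsub>R\<^esub>"] by simp
      qed
    qed (auto simp: psi_def R.l_distr S_carr N_add)
    show "x \<otimes>\<^bsub>R\<^esub> r \<in> psi S R ?N" if "x \<in> psi S R ?N" "r \<in> carrier R" for x r
      using l_closed[OF that] that by (simp add: psi_def R.m_comm)
  qed (fact R.ring_axioms, fact l_closed)
qed

lemma psi_nilradical_image:
  assumes "E_morphism h S R T M" and x: "x \<in> psi S R (nilradical S)"
  shows "h x \<in> psi T M (nilradical T)"
proof -
  have S: "i_extension S R" and T: "i_extension T M"
    and h: "h \<in> ring_hom R M" and surj: "h ` carrier S = carrier T"
    using assms by (simp_all add: E_morphism_def E_object_def)
  interpret I: rng_ideal "carrier S" R using S by (simp add: i_extension_def)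
  have hS: "h s \<in> carrier T" if "s \<in> carrier S" for s using surj that by blast
  have rng: "comm_rng S" using S by (simp add: i_extension_def)
  \<comment> \<open>Since the operations of \<open>S\<close> and \<open>T\<close> are those of
    \<open>R\<close> and \<open>M\<close>, \<open>h\<close> restricts to a map from \<open>S\<close>
    onto \<open>T\<close> that respects both operations.\<close>
  have add: "h \<in> hom (add_monoid S) (add_monoid T)"
    using S T hS I.a_Hcarr by (auto simp: hom_def i_extension_def ring_hom_add[OF h])
  have mult: "h (a \<otimes>\<^bsub>S\<^esub> b) = h a \<otimes>\<^bsub>T\<^esub> h b" if "a \<in> carrier S" "b \<in> carrier S" for a b
    using that S T hS I.a_Hcarr by (simp add: i_extension_def ring_hom_mult[OF h])
  note N = nilradical_image[OF rng add mult surj]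
  have "h x \<otimes>\<^bsub>M\<^esub> h s \<in> nilradical T" if s: "s \<in> carrier S" for s
  proof -
    have "h x \<otimes>\<^bsub>M\<^esub> h s = h (x \<otimes>\<^bsub>R\<^esub> s)"
      using x I.a_Hcarr[OF s] by (simp add: psi_def ring_hom_mult[OF h])
    then show ?thesis using x s N by (simp add: psi_def)
  qed
  \<comment> \<open>Rewriting \<open>carrier T\<close> as the image of \<open>carrier S\<close>
    reduces the condition on \<open>h x\<close> to the multipliers \<open>h s\<close>.\<close>
  then show ?thesis
    using x ring_hom_closed[OF h] unfolding psi_def surj[symmetric] by simp
qed

text \<open>Writing r' = i + r with i in \<open>I\<close>, the elements \<open>h r'\<close> and
  \<open>h r\<close> differ by \<open>h i\<close>, which lies in \<open>J\<close>. The
  representative \<open>r'\<close> ranges over the whole coset because \<open>Q_map\<close> takes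
  the image of all of it.\<close>

lemma (in ring_hom_ring) rcos_image_cong:
  assumes "ideal I R" "ideal J S" and IJ: "\<And>x. x \<in> I \<Longrightarrow> h x \<in> J"
    and r: "r \<in> carrier R" and r': "r' \<in> I +>\<^bsub>R\<^esub> r"
  shows "J +>\<^bsub>S\<^esub> h r' = J +>\<^bsub>S\<^esub> h r"
proof -
  interpret I: ideal I R by fact
  interpret J: ideal J S by fact
  obtain i where i: "i \<in> I" "r' = i \<oplus>\<^bsub>R\<^esub> r"
    using r' by (auto simp: a_r_coset_def')
  then have "h r' \<in> J +>\<^bsub>S\<^esub> h r"
    using IJ[OF i(1)] r by (auto simp: a_r_coset_def')
  then show ?thesis
    using r by (intro J.a_repr_independence'[symmetric]) simp_all
qed

theorem proposition8:
  fixes S :: "('a, 'm) ring_scheme" and R :: "('a, 'n) ring_scheme"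
    and T :: "('b, 'p) ring_scheme" and M :: "('b, 'q) ring_scheme"
    and h :: "'a \<Rightarrow> 'b"
  assumes "E_morphism h S R T M"
  shows "(\<forall>r\<in>carrier R. \<forall>r'\<in>carrier R.
            psi S R (nilradical S) +>\<^bsub>R\<^esub> r = psi S R (nilradical S) +>\<^bsub>R\<^esub> r' \<longrightarrow>
            psi T M (nilradical T) +>\<^bsub>M\<^esub> h r = psi T M (nilradical T) +>\<^bsub>M\<^esub> h r') \<and>
         (\<forall>r\<in>carrier R. Q_map h T M (psi S R (nilradical S) +>\<^bsub>R\<^esub> r)
            = psi T M (nilradical T) +>\<^bsub>M\<^esub> h r) \<and>
         ring_hom_cring (Q_obj S R) (Q_obj T M) (Q_map h T M)"
proof -
  let ?I = "psi S R (nilradical S)" and ?J = "psi T M (nilradical T)"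
  interpret R: cring R using assms by (simp add: E_morphism_def E_object_def)
  interpret M: cring M using assms by (simp add: E_morphism_def E_object_def)
  interpret h: ring_hom_cring R M h
    using assms by unfold_locales (simp add: E_morphism_def)
  interpret I: ideal ?I R
    using assms by (intro psi_nilradical_ideal) (simp add: E_morphism_def)
  interpret J: ideal ?J M
    using assms by (intro psi_nilradical_ideal) (simp add: E_morphism_def)
  have cong: "?J +>\<^bsub>M\<^esub> h r' = ?J +>\<^bsub>M\<^esub> h r" if "r \<in> carrier R" "r' \<in> ?I +>\<^bsub>R\<^esub> r" for r r'
    by (rule h.ring.rcos_image_cong[OF I.ideal_axioms J.ideal_axioms
        psi_nilradical_image[OF assms] that])
  have self: "r \<in> ?I +>\<^bsub>R\<^esub> r" if "r \<in> carrier R" for r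
    using that by (rule I.a_rcos_self)
  have value_eq: "Q_map h T M (?I +>\<^bsub>R\<^esub> r) = ?J +>\<^bsub>M\<^esub> h r" if r: "r \<in> carrier R" for r
  proof -
    \<comment> \<open>\<open>cong\<close> makes all values equal and \<open>self\<close> makes the
      coset nonempty, so \<open>the_elem\<close> is applied to a singleton.\<close>
    have "(\<lambda>r. ?J +>\<^bsub>M\<^esub> h r) ` (?I +>\<^bsub>R\<^esub> r) = {?J +>\<^bsub>M\<^esub> h r}"
      using cong[OF r] self[OF r] by blast
    then show ?thesis by (simp add: Q_map_def)
  qed
  \<comment> \<open>Every element of the quotient is a coset of some \<open>r\<close>, so
    \<open>value_eq\<close> reduces the homomorphism laws to those of \<open>h\<close>.\<close>
  have "Q_map h T M \<in> ring_hom (R Quot ?I) (M Quot ?J)"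
    by (rule ring_hom_memI)
      (auto simp: FactRing_def A_RCOSETS_def' value_eq I.rcoset_mult_add J.rcoset_mult_add
        I.a_rcos_sum J.a_rcos_sum)
  then have "ring_hom_cring (Q_obj S R) (Q_obj T M) (Q_map h T M)"
    unfolding Q_obj_def
    by (intro ring_hom_cring.intro ring_hom_cring_axioms.intro I.quotient_is_cring
        J.quotient_is_cring R.cring_axioms M.cring_axioms)
  \<comment> \<open>Independence of the representative follows by evaluating \<open>Q_map\<close> at
    the common coset in two ways.\<close>
  moreover have "?J +>\<^bsub>M\<^esub> h r = ?J +>\<^bsub>M\<^esub> h r'"
    if "r \<in> carrier R" "r' \<in> carrier R" "?I +>\<^bsub>R\<^esub> r = ?I +>\<^bsub>R\<^esub> r'" for r r'
    using that value_eq[of r] value_eq[of r'] by simp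
  ultimately show ?thesis
    by (intro conjI ballI impI value_eq)
qed

end
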